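(* Let $(K,v)$ be a henselian valued field and let $w$ be a valuation-transcendental extension of $v$ to $K(X)$ with $w=w_Q$, where $Q\in K[X]$ is an abstract key polynomial (ABKP) for $w$. If $(Q_r=Q,Q_{r-1},\ldots,Q_0)$ is a saturated distinguished chain for $Q$, then $\Lambda=\{Q_0\}\cup\{Q_1\}\cup\cdots\cup\{Q_r\}$ (indexed by $\Delta=\{0,1,\ldots,r\}$) is a complete set of ABKPs for $w$.
   Context: Valuations have arbitrary rank. $\overline K$ is a fixed algebraic closure of $K$, $\bar v$ is the unique extension of $v$ to $\overline K$ ($v$ is henselian), and $\deg\alpha:=[K(\alpha):K]$ for $\alpha\in\overline K$. $\overline w$ is a fixed common extension of $w$ and $\bar v$ to $\overline K(X)$. $\Gamma_u$ and $k_u$ denote the value group and residue field of a valuation $u$. Valuation-transcendental: $w$ is valuation-transcendental if it is either residually transcendental ($k_w/k_v$ is a transcendental extension) or value-transcendental ($\Gamma_w/\Gamma_v$ is a torsion-free group and $k_w$ is algebraic over $k_v$, as the paper phrases it). Optimal value: for $f\in K[X]$, $\delta(f):=\max\{\overline w(X-\alpha)\mid \alpha\in\overline K,\ f(\alpha)=0\}$; a root attaining the maximum is an optimizing root of $f$. A monic $Q\in K[X]$ is an ABKP for $w$ if $\delta(f)<\delta(Q)$ for every $f\in K[X]$ with $\deg f<\deg Q$ (constants impose no condition). Truncation: $w_Q(f):=\min_{i} w(f_iQ^i)$, where $f=\sum_i f_iQ^i$ with $\deg f_i<\deg Q$ is the $Q$-expansion of $f$. If $Q$ is an ABKP for $w$,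 then $w_Q$ is a valuation. Distinguished pairs: a pair $(\theta,\alpha)$ of elements of $\overline K$ is a $(K,v)$-distinguished pair if (i) $\deg\theta>\deg\alpha$; (ii) $\bar v(\theta-\alpha)=\max\{\bar v(\theta-\beta)\mid\beta\in\overline K,\ \deg\beta<\deg\theta\}$; (iii) every $\eta\in\overline K$ with $\deg\eta<\deg\alpha$ satisfies $\bar v(\theta-\eta)<\bar v(\theta-\alpha)$. For monic irreducible $g,f\in K[X]$, $(g,f)$ is a distinguished pair if some root $\theta$ of $g$ and some root $\alpha$ of $f$ form a $(K,v)$-distinguished pair $(\theta,\alpha)$. A sequence $(Q_r=Q,Q_{r-1},\ldots,Q_0)$ of monic irreducible polynomials is a saturated distinguished chain for $Q$ if $(Q_{i+1},Q_i)$ is a distinguished pair for each $0\le i\le r-1$ and $\deg Q_0=1$. Complete set: a family $\{Q_i\}_{i\in\Delta}$ of ABKPs for $w$, indexed by a totally ordered set $\Delta$, is a complete set of ABKPs for $w$ if (i) $\delta(Q_i)\ne\delta(Q_j)$ for $i\neq j$; (ii) the family is well-ordered by the ordering $Q_i<Q_j\iff\delta(Q_i)<\delta(Q_j)$, compatibly with the order of $\Delta$ (i.e. $i<j$ implies $\delta(Q_i)<\delta(Q_j)$); (iii) for every $f\in K[X]$ there is some $i\in\Delta$ with $w_{Q_i}(f)=w(f)$. *)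

theory Defs
  imports
    "HOL-Algebra.Algebraic_Closure_Type"
    "HOL-Algebra.Generated_Fields"
    "HOL-Library.Extended"
begin

text \<open>
  The base field \<open>K\<close> is the type \<open>'a::field\<close>, its algebraic closure is \<open>'a alg_closure\<close>, and the
  rational function fields over \<open>K\<close> and over its closure are the fraction fields of the polynomial rings.

  Valuations are written additively, of arbitrary rank, with values in \<open>'g \<union> {\<infinity>}\<close> for an arbitrary
  linearly ordered abelian group \<open>'g\<close>; they need not be surjective.  A valuation and its extensions
  take their values in the same \<open>'g\<close> (any group containing the value group of the largest
  extension), so that ``extends'' is plain equality of values.  The element \<open>-\<infinity>\<close> of the library type
  is never a value.
\<close>

definition is_valuation :: "('a::field \<Rightarrow> 'g::linordered_ab_group_add extended) \<Rightarrow> bool" where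
  "is_valuation u \<longleftrightarrow>
     (\<forall>x. u x \<noteq> -\<infinity>) \<and>
     (\<forall>x. u x = \<infinity> \<longleftrightarrow> x = 0) \<and>
     (\<forall>x y. u (x * y) = u x + u y) \<and>
     (\<forall>x y. min (u x) (u y) \<le> u (x + y))"


subsection \<open>Extensions of valuations\<close>

definition const_fract :: "'a::field \<Rightarrow> 'a poly fract" where
  "const_fract a = to_fract [:a:]"

definition extends_to_closure ::
  "('a::field alg_closure \<Rightarrow> 'g extended) \<Rightarrow> ('a \<Rightarrow> 'g extended) \<Rightarrow> bool" where
  "extends_to_closure vbar v \<longleftrightarrow> (\<forall>a. vbar (to_ac a) = v a)"

definition extends_to_rat_fun ::
  "('k::field poly fract \<Rightarrow> 'g extended) \<Rightarrow> ('k \<Rightarrow> 'g extended) \<Rightarrow> bool" where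
  "extends_to_rat_fun w v \<longleftrightarrow> (\<forall>a. w (const_fract a) = v a)"

definition extends_to_closure_rat_fun ::
  "('a::field alg_closure poly fract \<Rightarrow> 'g extended) \<Rightarrow> ('a poly fract \<Rightarrow> 'g extended) \<Rightarrow> bool" where
  "extends_to_closure_rat_fun wbar w \<longleftrightarrow>
     (\<forall>f g. g \<noteq> 0 \<longrightarrow> wbar (Fract (map_poly to_ac f) (map_poly to_ac g)) = w (Fract f g))"

text \<open>
  \<open>v\<close> is henselian if it has exactly one extension to the algebraic closure.  Extensions are counted
  up to equivalence, that is, by their valuation rings: this makes the notion independent of a choice
  of value group for the extensions.
\<close>

definition henselian :: "('a::field \<Rightarrow> 'g::linordered_ab_group_add extended) \<Rightarrow> bool" where
  "henselian v \<longleftrightarrow>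
     (\<exists>!A. subring A (ring_of_type_algebra :: 'a alg_closure ring) \<and>
           (\<forall>x. x \<noteq> 0 \<longrightarrow> x \<in> A \<or> inverse x \<in> A) \<and>
           (\<forall>a. to_ac a \<in> A \<longleftrightarrow> 0 \<le> v a))"


subsection \<open>Value groups, residue fields, valuation-transcendental extensions\<close>

definition value_group :: "('k::field \<Rightarrow> 'g::linordered_ab_group_add extended) \<Rightarrow> 'g monoid" where
  "value_group u = \<lparr>carrier = {\<gamma>. Fin \<gamma> \<in> range u}, monoid.mult = (+), one = 0\<rparr>"

definition torsion_free :: "('b, 'm) monoid_scheme \<Rightarrow> bool" where
  "torsion_free G \<longleftrightarrow>
     (\<forall>x\<in>carrier G. \<forall>n::nat. n > 0 \<longrightarrow> x [^]\<^bsub>G\<^esub> n = \<one>\<^bsub>G\<^esub> \<longrightarrow> x = \<one>\<^bsub>G\<^esub>)"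

definition valuation_ring :: "('k::field \<Rightarrow> 'g::linordered_ab_group_add extended) \<Rightarrow> 'k ring" where
  "valuation_ring u = ring_of_type_algebra\<lparr>carrier := {x. 0 \<le> u x}\<rparr>"

definition maximal_ideal_of :: "('k::field \<Rightarrow> 'g::linordered_ab_group_add extended) \<Rightarrow> 'k set" where
  "maximal_ideal_of u = {x. 0 < u x}"

definition residue_field :: "('k::field \<Rightarrow> 'g::linordered_ab_group_add extended) \<Rightarrow> 'k set ring" where
  "residue_field u = valuation_ring u Quot maximal_ideal_of u"

text \<open>The canonical image of \<open>k\<^sub>v\<close> in \<open>k\<^sub>w\<close>, for \<open>w\<close> extending \<open>v\<close> to \<open>K(X)\<close>.\<close>

definition residue_subfield ::
  "('k::field \<Rightarrow> 'g::linordered_ab_group_add extended) \<Rightarrow> ('k poly fract \<Rightarrow> 'g extended) \<Rightarrow>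
   'k poly fract set set" where
  "residue_subfield v w =
     (\<lambda>a. maximal_ideal_of w +>\<^bsub>valuation_ring w\<^esub> const_fract a) ` carrier (valuation_ring v)"

definition residually_transcendental ::
  "('k::field \<Rightarrow> 'g::linordered_ab_group_add extended) \<Rightarrow> ('k poly fract \<Rightarrow> 'g extended) \<Rightarrow> bool" where
  "residually_transcendental v w \<longleftrightarrow>
     (\<exists>x\<in>carrier (residue_field w).
        (ring.transcendental (residue_field w) over residue_subfield v w) x)"

text \<open>
  Torsion-freeness is all that is required of the quotient of value groups; in particular the quotient
  may be trivial.
\<close>

definition value_transcendental ::
  "('k::field \<Rightarrow> 'g::linordered_ab_group_add extended) \<Rightarrow> ('k poly fract \<Rightarrow> 'g extended) \<Rightarrow> bool" where
  "value_transcendental v w \<longleftrightarrow>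
     torsion_free (value_group w Mod carrier (value_group v)) \<and>
     (\<forall>x\<in>carrier (residue_field w).
        (ring.algebraic (residue_field w) over residue_subfield v w) x)"

definition valuation_transcendental ::
  "('k::field \<Rightarrow> 'g::linordered_ab_group_add extended) \<Rightarrow> ('k poly fract \<Rightarrow> 'g extended) \<Rightarrow> bool" where
  "valuation_transcendental v w \<longleftrightarrow> residually_transcendental v w \<or> value_transcendental v w"


subsection \<open>Abstract key polynomials and truncations\<close>

abbreviation roots_in_closure :: "'a::field poly \<Rightarrow> 'a alg_closure set" where
  "roots_in_closure f \<equiv> {\<alpha>. poly (map_poly to_ac f) \<alpha> = 0}"

text \<open>Only meaningful for nonconstant \<open>f\<close>, whose set of roots is finite and nonempty.\<close>

definition optimal_value ::
  "('a::field alg_closure poly fract \<Rightarrow> 'g::linordered_ab_group_add extended) \<Rightarrow> 'a poly \<Rightarrow> 'g extended"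
  where
  "optimal_value wbar f = Max ((\<lambda>\<alpha>. wbar (to_fract [:- \<alpha>, 1:])) ` roots_in_closure f)"

text \<open>
  A key polynomial must have a root for its optimal value to make sense, hence be nonconstant;
  constants impose no condition on it.
\<close>

definition is_ABKP ::
  "('a::field alg_closure poly fract \<Rightarrow> 'g::linordered_ab_group_add extended) \<Rightarrow> 'a poly \<Rightarrow> bool" where
  "is_ABKP wbar Q \<longleftrightarrow>
     Polynomial.lead_coeff Q = 1 \<and> Polynomial.degree Q > 0 \<and>
     (\<forall>f. 0 < Polynomial.degree f \<and> Polynomial.degree f < Polynomial.degree Q \<longrightarrow>
          optimal_value wbar f < optimal_value wbar Q)"

definition expansion_coeff :: "'a::field poly \<Rightarrow> 'a poly \<Rightarrow> nat \<Rightarrow> 'a poly" where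
  "expansion_coeff Q f i = (f div Q ^ i) mod Q"

lemma degree_expansion_coeff:
  assumes "Polynomial.degree Q > 0"
  shows "Polynomial.degree (expansion_coeff Q f i) < Polynomial.degree Q"
  using assms unfolding expansion_coeff_def using degree_mod_less'[of Q "f div Q ^ i"] by fastforce

lemma expansion:
  fixes Q f :: "'a::field poly"
  assumes "Polynomial.degree Q > 0"
  shows "f = (\<Sum>i\<le>Polynomial.degree f. expansion_coeff Q f i * Q ^ i)"
proof -
  have *: "f = (\<Sum>i<n. expansion_coeff Q f i * Q ^ i) + (f div Q ^ n) * Q ^ n" for n
  proof (induction n)
    case (Suc n)
    have "f div Q ^ n = (f div Q ^ n div Q) * Q + expansion_coeff Q f n"
      unfolding expansion_coeff_def by simp
    moreover have "f div Q ^ n div Q = f div Q ^ Suc n"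
      by (metis poly_div_mult_right power_Suc2)
    ultimately have "(f div Q ^ n) * Q ^ n = expansion_coeff Q f n * Q ^ n + (f div Q ^ Suc n) * Q ^ Suc n"
      by (metis (no_types, lifting) add.commute distrib_right mult.assoc power_Suc)
    with Suc show ?case by (simp add: add.assoc)
  qed simp
  have "Polynomial.degree f < Polynomial.degree (Q ^ Suc (Polynomial.degree f))"
  proof -
    have "Suc (Polynomial.degree f) * 1 \<le> Suc (Polynomial.degree f) * Polynomial.degree Q"
      using assms by (intro mult_le_mono2) simp
    moreover have "Q \<noteq> 0" using assms by auto
    ultimately show ?thesis by (simp add: degree_power_eq del: power_Suc)
  qed
  then have "f div Q ^ Suc (Polynomial.degree f) = 0"
    by (rule div_poly_less)
  with *[of "Suc (Polynomial.degree f)"] show ?thesis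
    by (simp add: lessThan_Suc_atMost)
qed

text \<open>\<open>w\<^sub>Q\<close> on \<open>K[X]\<close>; the omitted coefficients, those of index \<open>i > deg f\<close>, vanish.\<close>

definition truncation ::
  "('k::field poly fract \<Rightarrow> 'g::linordered_ab_group_add extended) \<Rightarrow> 'k poly \<Rightarrow> 'k poly \<Rightarrow> 'g extended"
  where
  "truncation w Q f =
     Min ((\<lambda>i. w (to_fract (expansion_coeff Q f i * Q ^ i))) ` {..Polynomial.degree f})"


subsection \<open>Distinguished pairs and chains\<close>

text \<open>\<open>[K(\<alpha>):K]\<close>, which is always finite for \<open>\<alpha>\<close> in the algebraic closure.\<close>

definition deg_over :: "'a::field alg_closure \<Rightarrow> nat" where
  "deg_over \<alpha> =
     (ring.dim ring_of_type_algebra over range to_ac)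
       (generate_field ring_of_type_algebra (insert \<alpha> (range to_ac)))"

text \<open>
  In the second condition the maximum is over the values \<open>vbar (\<theta> - \<beta>)\<close> with
  \<open>deg_over \<beta> < deg_over \<theta>\<close>; that the maximum is attained at \<open>\<alpha>\<close>
  is the upper bound together with the first condition.
\<close>

definition distinguished_pair ::
  "('a::field alg_closure \<Rightarrow> 'g::linordered_ab_group_add extended) \<Rightarrow>
   'a alg_closure \<Rightarrow> 'a alg_closure \<Rightarrow> bool" where
  "distinguished_pair vbar \<theta> \<alpha> \<longleftrightarrow>
     deg_over \<alpha> < deg_over \<theta> \<and>
     (\<forall>\<beta>. deg_over \<beta> < deg_over \<theta> \<longrightarrow> vbar (\<theta> - \<beta>) \<le> vbar (\<theta> - \<alpha>)) \<and>
     (\<forall>\<eta>. deg_over \<eta> < deg_over \<alpha> \<longrightarrow> vbar (\<theta> - \<eta>) < vbar (\<theta> - \<alpha>))"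

definition distinguished_poly_pair ::
  "('a::field alg_closure \<Rightarrow> 'g::linordered_ab_group_add extended) \<Rightarrow> 'a poly \<Rightarrow> 'a poly \<Rightarrow> bool" where
  "distinguished_poly_pair vbar g f \<longleftrightarrow>
     (\<exists>\<theta>\<in>roots_in_closure g. \<exists>\<alpha>\<in>roots_in_closure f. distinguished_pair vbar \<theta> \<alpha>)"

definition saturated_distinguished_chain ::
  "('a::field alg_closure \<Rightarrow> 'g::linordered_ab_group_add extended) \<Rightarrow>
   'a poly \<Rightarrow> nat \<Rightarrow> (nat \<Rightarrow> 'a poly) \<Rightarrow> bool" where
  "saturated_distinguished_chain vbar Q r Qs \<longleftrightarrow>
     Qs r = Q \<and>
     (\<forall>i\<le>r. Polynomial.lead_coeff (Qs i) = 1 \<and> Factorial_Ring.irreducible (Qs i)) \<and>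
     (\<forall>i<r. distinguished_poly_pair vbar (Qs (Suc i)) (Qs i)) \<and>
     Polynomial.degree (Qs 0) = 1"


subsection \<open>Complete sets\<close>

definition complete_set_of_ABKPs ::
  "('a::field poly fract \<Rightarrow> 'g::linordered_ab_group_add extended) \<Rightarrow>
   ('a alg_closure poly fract \<Rightarrow> 'g extended) \<Rightarrow> 'i::linorder set \<Rightarrow> ('i \<Rightarrow> 'a poly) \<Rightarrow> bool" where
  "complete_set_of_ABKPs w wbar \<Delta> Qs \<longleftrightarrow>
     (\<forall>i\<in>\<Delta>. is_ABKP wbar (Qs i)) \<and>
     (\<forall>i\<in>\<Delta>. \<forall>j\<in>\<Delta>. i \<noteq> j \<longrightarrow> optimal_value wbar (Qs i) \<noteq> optimal_value wbar (Qs j)) \<and>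
     well_order_on \<Delta> {(i, j) \<in> \<Delta> \<times> \<Delta>. optimal_value wbar (Qs i) \<le> optimal_value wbar (Qs j)} \<and>
     (\<forall>i\<in>\<Delta>. \<forall>j\<in>\<Delta>. i < j \<longrightarrow> optimal_value wbar (Qs i) < optimal_value wbar (Qs j)) \<and>
     (\<forall>f. \<exists>i\<in>\<Delta>. truncation w (Qs i) f = w (to_fract f))"

end

theory Submission
  imports Defs
begin

text \<open>
  Since \<open>w = w\<^sub>Q\<close> and \<open>Q = Q\<^sub>r\<close>, the last polynomial of the chain alone computes \<open>w\<close>.  What has to be
  proved is that every \<open>Q\<^sub>i\<close> is an ABKP and that \<open>\<delta>(Q\<^sub>0) < \<dots> < \<delta>(Q\<^sub>r)\<close>.  This goes by descending
  induction, starting from the ABKP \<open>Q\<^sub>r\<close>; the inductive step is the lemma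
  \<open>ABKP_distinguished_pair\<close>: if \<open>(g, f)\<close> is a distinguished pair and \<open>g\<close> is an ABKP, then so is \<open>f\<close>,
  and \<open>\<delta>(f) < \<delta>(g)\<close>.

  Let \<open>(\<theta>, \<alpha>)\<close> be a distinguished pair of roots of \<open>g\<close> and \<open>f\<close>, and suppose that \<open>\<theta>\<close> is an
  optimizing root of \<open>g\<close>.  If \<open>\<beta>\<close> is a root of a polynomial \<open>h\<close> with \<open>deg h < deg g\<close>, then
  \<open>wbar (X - \<beta>) \<le> \<delta>(h) < \<delta>(g) = wbar (X - \<theta>)\<close>, so that \<open>wbar (X - \<beta>) = vbar (\<theta> - \<beta>)\<close> by the
  ultrametric inequality.  For \<open>deg h < deg f\<close>, the third condition on a distinguished pair says
  \<open>vbar (\<theta> - \<beta>) < vbar (\<theta> - \<alpha>)\<close>.  Applied to an optimizing root \<open>\<beta>\<close> of \<open>h\<close> this reads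
  \<open>\<delta>(h) = wbar (X - \<beta>) < wbar (X - \<alpha>) \<le> \<delta>(f)\<close>.

  A distinguished pair is only given for some root \<open>\<theta>\<close> of \<open>g\<close>, so it has to be moved to an optimizing
  one.  An automorphism \<open>\<sigma>\<close> of the closure over \<open>K\<close> takes \<open>\<theta>\<close> to any other root of \<open>g\<close>
  (\<open>conjugate_roots\<close>, by Zorn's lemma), and \<open>\<sigma>\<close> preserves \<open>vbar\<close> because \<open>v\<close> is henselian
  (\<open>henselian_embedding_invariant\<close>).  Degrees over \<open>K\<close> enter through
  \<open>deg_over_eq_degree\<close>, which identifies \<open>[K(x):K]\<close> with the degree
  of an irreducible polynomial having \<open>x\<close> as a root.
\<close>

section \<open>Polynomials over the base field and their roots in the closure\<close>

abbreviation root_eval :: "'a::field poly \<Rightarrow> 'a alg_closure \<Rightarrow> 'a alg_closure" where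
  "root_eval f x \<equiv> poly (map_poly to_ac f) x"

lemma root_eval_pCons [simp]: "root_eval (pCons a f) x = to_ac a + x * root_eval f x"
  by (simp add: map_poly_pCons)

lemma root_eval_add [simp]: "root_eval (f + g) x = root_eval f x + root_eval g x"
proof -
  have "map_poly to_ac (f + g) = map_poly to_ac f + map_poly to_ac g"
    by (rule poly_eqI) (simp add: coeff_map_poly)
  thus ?thesis by simp
qed

lemma root_eval_mult [simp]: "root_eval (f * g) x = root_eval f x * root_eval g x"
proof -
  have "map_poly to_ac (f * g) = map_poly to_ac f * map_poly to_ac g"
    by (rule poly_eqI) (simp add: coeff_map_poly Polynomial.coeff_mult to_ac_sum)
  thus ?thesis by simp
qed

lemma root_eval_smult [simp]: "root_eval (Polynomial.smult c f) x = to_ac c * root_eval f x"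
  by (simp add: map_poly_smult)

lemma map_poly_to_ac_eq_0_iff [simp]: "map_poly to_ac f = 0 \<longleftrightarrow> f = 0"
  by (rule map_poly_eq_0_iff) auto

lemma degree_map_poly_to_ac [simp]:
  "Polynomial.degree (map_poly to_ac f) = Polynomial.degree f"
  by (rule degree_map_poly) auto

lemma finite_roots_in_closure: "f \<noteq> 0 \<Longrightarrow> finite (roots_in_closure f)"
  by (rule poly_roots_finite) simp

lemma roots_in_closure_nonempty:
  assumes "Polynomial.degree f > 0"
  shows "roots_in_closure f \<noteq> {}"
  using alg_closed_imp_poly_has_root[of "map_poly to_ac f"] assms by auto

lemma degree_pos_of_root:
  assumes "f \<noteq> 0" and "root_eval f x = 0"
  shows "Polynomial.degree f > 0"
  using assms by (cases f) (auto split: if_splits elim: Polynomial.degree_eq_zeroE)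

text \<open>A nonzero polynomial of least degree among those vanishing at \<open>x\<close>: division with remainder gives
  divisibility, and a factorization into polynomials of smaller degree would contradict minimality.\<close>

lemma root_has_irreducible_poly:
  fixes x :: "'a::field alg_closure"
  obtains m :: "'a poly" where "Factorial_Ring.irreducible m" "root_eval m x = 0"
    "\<And>f. root_eval f x = 0 \<Longrightarrow> m dvd f"
proof -
  define P where "P = (\<lambda>f::'a poly. f \<noteq> 0 \<and> root_eval f x = 0)"
  obtain m where m: "P m" and min: "\<And>f. P f \<Longrightarrow> Polynomial.degree m \<le> Polynomial.degree f"
    using alg_closure_algebraic[of x] exists_least_iff[of "\<lambda>n. \<exists>f. P f \<and> Polynomial.degree f = n"]
    unfolding P_def by (metis linorder_le_less_linear)
  have dvd: "m dvd f" if "root_eval f x = 0" for f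
  proof (rule ccontr)
    assume "\<not> m dvd f"
    hence nz: "f mod m \<noteq> 0" by (simp add: dvd_eq_mod_eq_0)
    have "root_eval (f div m * m + f mod m) x = 0" using that by simp
    hence "root_eval (f mod m) x = 0"
      using m unfolding root_eval_add root_eval_mult P_def by simp
    hence "Polynomial.degree m \<le> Polynomial.degree (f mod m)"
      using nz by (intro min) (simp add: P_def)
    moreover have "Polynomial.degree (f mod m) < Polynomial.degree m"
      using m nz by (intro degree_mod_less') (auto simp: P_def)
    ultimately show False by simp
  qed
  have "Factorial_Ring.irreducible m"
  proof (rule Factorial_Ring.irreducibleI)
    show "m \<noteq> 0" using m by (simp add: P_def)
    show "\<not> m dvd 1"
      using m degree_pos_of_root[of m x] by (auto simp: P_def is_unit_iff_degree)
  next
    fix a b assume ab: "m = a * b"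
    have nz: "a \<noteq> 0" "b \<noteq> 0" using m ab by (auto simp: P_def)
    hence deg: "Polynomial.degree m = Polynomial.degree a + Polynomial.degree b"
      using ab by (simp add: Polynomial.degree_mult_eq)
    have "root_eval a x = 0 \<or> root_eval b x = 0" using m ab by (simp add: P_def)
    hence "Polynomial.degree m \<le> Polynomial.degree a \<or> Polynomial.degree m \<le> Polynomial.degree b"
      using min nz unfolding P_def by blast
    thus "a dvd 1 \<or> b dvd 1" using deg nz by (auto simp: is_unit_iff_degree)
  qed
  thus thesis using that m dvd by (auto simp: P_def)
qed

lemma irreducible_dvd_of_common_root:
  assumes "Factorial_Ring.irreducible p" and "root_eval p x = 0" and "root_eval f x = 0"
  shows "p dvd f"
proof -
  obtain m where m: "Factorial_Ring.irreducible m" "\<And>f. root_eval f x = 0 \<Longrightarrow> m dvd f"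
    by (rule root_has_irreducible_poly[of x]) blast
  from m(2)[OF assms(2)] obtain k where k: "p = m * k" by (elim dvdE)
  with assms(1) m(1) have "k dvd 1"
    using Factorial_Ring.irreducibleD Factorial_Ring.irreducible_not_unit by blast
  hence "p dvd m" using k by simp
  thus ?thesis using m(2)[OF assms(3)] by (rule dvd_trans)
qed

section \<open>The degree of an algebraic element\<close>

text \<open>The dimension that defines \<open>deg_over\<close> is known for simple extensions in terms of the minimal
  polynomial \<open>Irr\<close>, a list of coefficients in the carrier-based algebra library.  The lemmas of this
  context translate between such lists (leading coefficient first) and the type of polynomials.\<close>

context
  fixes L :: "'a::field alg_closure ring"
  defines "L \<equiv> ring_of_type_algebra"
begin

interpretation L: field L
  unfolding L_def by rule

lemma ring_of_type_simps:
  "carrier L = UNIV" "x \<otimes>\<^bsub>L\<^esub> y = x * y" "x \<oplus>\<^bsub>L\<^esub> y = x + y" "\<zero>\<^bsub>L\<^esub> = 0" "\<one>\<^bsub>L\<^esub> = 1"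
  by (simp_all add: L_def ring_of_type_algebra_def)

lemma ring_of_type_uminus: "\<ominus>\<^bsub>L\<^esub> x = - x"
proof -
  have "x \<oplus>\<^bsub>L\<^esub> (- x) = \<zero>\<^bsub>L\<^esub>" by (simp add: ring_of_type_simps)
  thus ?thesis using L.minus_equality[of "-x" x] by (simp add: ring_of_type_simps)
qed

lemma ring_of_type_inv: "x \<noteq> 0 \<Longrightarrow> inv\<^bsub>L\<^esub> x = inverse x"
  using L.comm_inv_char[of x "inverse x"] by (simp add: ring_of_type_simps)

lemma ring_of_type_pow: "x [^]\<^bsub>L\<^esub> (n::nat) = x ^ n"
  by (induction n) (simp_all add: ring_of_type_simps)

lemma eval_eq_root_eval: "L.eval (map to_ac cs) x = root_eval (Poly (rev cs)) x"
proof (induction cs)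
  case (Cons c cs)
  have mono: "root_eval (Polynomial.monom c n) x = to_ac c * x ^ n" for c n
    by (simp add: map_poly_monom poly_monom)
  show ?case
    using Cons by (simp add: ring_of_type_simps ring_of_type_pow Poly_append mono add.commute)
qed (simp add: ring_of_type_simps)

lemma subfield_range_to_ac: "subfield (range to_ac) L"
proof (rule L.subfieldI')
  show "subring (range to_ac) L"
    by (rule L.subringI)
       (auto simp: ring_of_type_simps ring_of_type_uminus image_iff
          simp flip: to_ac_1 to_ac_minus to_ac_mult to_ac_add)
  show "inv\<^bsub>L\<^esub> k \<in> range to_ac" if "k \<in> range to_ac - {\<zero>\<^bsub>L\<^esub>}" for k
    using that by (auto simp: ring_of_type_simps ring_of_type_inv simp flip: to_ac_inverse)
qed

lemma list_poly_of_poly: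
  fixes f :: "'a poly"
  assumes "f \<noteq> 0"
  defines "cs \<equiv> map to_ac (rev (coeffs f))"
  shows "cs \<in> carrier (univ_poly L (range to_ac))" "cs \<noteq> []"
    "Polynomials.degree cs = Polynomial.degree f" "L.eval cs x = root_eval f x"
proof -
  show ne: "cs \<noteq> []" using assms by (simp add: cs_def)
  show "cs \<in> carrier (univ_poly L (range to_ac))"
    using assms unfolding cs_def
    by (auto simp: univ_poly_def polynomial_def hd_map hd_rev last_coeffs_eq_coeff_degree ring_of_type_simps)
  show "Polynomials.degree cs = Polynomial.degree f"
    using assms by (simp add: cs_def degree_eq_length_coeffs)
  show "L.eval cs x = root_eval f x"
    unfolding cs_def by (simp add: eval_eq_root_eval)
qed

lemma poly_of_list_poly:
  assumes "cs \<in> carrier (univ_poly L (range to_ac))" "cs \<noteq> []"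
  obtains f :: "'a poly" where "f \<noteq> 0" "Polynomial.degree f \<le> Polynomials.degree cs"
    "\<And>x. root_eval f x = L.eval cs x"
proof -
  have "set cs \<subseteq> range to_ac" and hd: "hd cs \<noteq> 0"
    using assms by (auto simp: univ_poly_def polynomial_def ring_of_type_simps)
  then obtain ds where ds: "cs = map to_ac ds"
    by (metis ex_map_conv subset_iff rangeE)
  have "ds \<noteq> []" "hd ds \<noteq> 0" using ds hd assms(2) by (auto simp: hd_map)
  have c: "coeffs (Poly (rev ds)) = rev ds"
    using \<open>ds \<noteq> []\<close> \<open>hd ds \<noteq> 0\<close> by (cases ds) auto
  have "Poly (rev ds) \<noteq> 0" using c \<open>ds \<noteq> []\<close> by force
  moreover have "Polynomial.degree (Poly (rev ds)) \<le> Polynomials.degree cs"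
    unfolding degree_eq_length_coeffs c by (simp add: ds)
  ultimately show thesis
    using that[of "Poly (rev ds)"] by (simp add: ds eval_eq_root_eval)
qed

text \<open>\<open>Irr\<close> divides the list of \<open>p\<close>, and \<open>p\<close> divides the polynomial of \<open>Irr\<close>; so both have the same
  degree.\<close>

lemma dim_generate_field_eq_degree:
  assumes p: "Factorial_Ring.irreducible p" and x: "root_eval p x = 0"
  shows "(ring.dim L over range to_ac) (generate_field L (insert x (range to_ac)))
           = Polynomial.degree p"
proof -
  let ?K = "range (to_ac :: 'a \<Rightarrow> _)"
  note K = subfield_range_to_ac
  have sub: "subring ?K L" by (rule subfieldE(1)[OF K])
  have xL: "x \<in> carrier L" by (simp add: ring_of_type_simps)
  have "p \<noteq> 0" using p by auto
  note P = list_poly_of_poly[OF \<open>p \<noteq> 0\<close>]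
  have ev: "L.eval (map to_ac (rev (coeffs p))) x = \<zero>\<^bsub>L\<^esub>"
    using P(4) x by (simp add: ring_of_type_simps)
  have alg: "(L.algebraic over ?K) x"
    using L.algebraicI[OF P(1,2) ev] .
  have gen: "L.simple_extension ?K x = generate_field L (insert x ?K)"
  proof (rule L.generate_fieldI)
    show "subfield (L.simple_extension ?K x) L"
      using L.simple_extension_is_subfield[OF K xL] alg by simp
    show "insert x ?K \<subseteq> L.simple_extension ?K x"
      using L.simple_extension_incl[of ?K x] L.simple_extension_mem[OF sub xL]
      by (auto simp: ring_of_type_simps)
    show "L.simple_extension ?K x \<subseteq> F" if "subfield F L" "insert x ?K \<subseteq> F" for F
      using that by (intro L.simple_extension_subring_incl subfieldE(1)) auto
  qed (simp add: ring_of_type_simps)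
  have Irr: "L.Irr ?K x \<in> carrier (univ_poly L ?K)" "L.eval (L.Irr ?K x) x = \<zero>\<^bsub>L\<^esub>"
    "L.Irr ?K x \<noteq> []"
    using L.IrrE[OF K xL alg] L.pirreducibleE(1)[OF sub] by auto
  have "Polynomials.degree (L.Irr ?K x) \<le> Polynomial.degree p"
    using L.pdivides_imp_degree_le[OF sub Irr(1) P(1,2) L.Irr_minimal[OF K xL alg P(1) ev]] P(3)
    by simp
  moreover obtain f where f: "f \<noteq> 0" "Polynomial.degree f \<le> Polynomials.degree (L.Irr ?K x)"
    "root_eval f x = 0"
    using poly_of_list_poly[OF Irr(1,3)] Irr(2) by (metis ring_of_type_simps(4))
  moreover have "Polynomial.degree p \<le> Polynomial.degree f"
    using irreducible_dvd_of_common_root[OF p x f(3)] f(1) by (rule dvd_imp_degree_le)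
  ultimately have "Polynomials.degree (L.Irr ?K x) = Polynomial.degree p" by linarith
  thus ?thesis
    using L.simple_extension_dim[OF K xL alg] by (simp add: gen)
qed

end

lemma deg_over_eq_degree:
  assumes "Factorial_Ring.irreducible p" and "root_eval p x = 0"
  shows "deg_over x = Polynomial.degree p"
  unfolding deg_over_def by (rule dim_generate_field_eq_degree[OF assms])

lemma deg_over_le_degree:
  assumes "f \<noteq> 0" and "root_eval f x = 0"
  shows "deg_over x \<le> Polynomial.degree f"
proof -
  obtain m where m: "Factorial_Ring.irreducible m" "root_eval m x = 0" "m dvd f"
    using root_has_irreducible_poly[of x] assms(2) by metis
  thus ?thesis using deg_over_eq_degree[OF m(1,2)] dvd_imp_degree_le[OF m(3) assms(1)] by simp
qed

section \<open>Conjugation in the closure\<close>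

text \<open>The graph of a homomorphism over \<open>K\<close> from a subring of the closure into the closure.  Working with
  the graph, a subring of the product, avoids partial functions, and unions of chains stay in the
  class.\<close>

definition partial_embedding :: "('a::field alg_closure \<times> 'a alg_closure) set \<Rightarrow> bool" where
  "partial_embedding G \<longleftrightarrow>
     (\<forall>a. (to_ac a, to_ac a) \<in> G) \<and>
     (\<forall>x y x' y'. (x, y) \<in> G \<longrightarrow> (x', y') \<in> G \<longrightarrow> (x + x', y + y') \<in> G) \<and>
     (\<forall>x y x' y'. (x, y) \<in> G \<longrightarrow> (x', y') \<in> G \<longrightarrow> (x * x', y * y') \<in> G) \<and>
     (\<forall>y. (0, y) \<in> G \<longrightarrow> y = 0)"

lemma
  assumes "partial_embedding G"
  shows partial_embedding_const: "(to_ac a, to_ac a) \<in> G"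
    and partial_embedding_add: "(x, y) \<in> G \<Longrightarrow> (x', y') \<in> G \<Longrightarrow> (x + x', y + y') \<in> G"
    and partial_embedding_mult: "(x, y) \<in> G \<Longrightarrow> (x', y') \<in> G \<Longrightarrow> (x * x', y * y') \<in> G"
    and partial_embedding_zero: "(0, y) \<in> G \<Longrightarrow> y = 0"
  using assms unfolding partial_embedding_def by blast+

lemma partial_embedding_zero_zero: "partial_embedding G \<Longrightarrow> (0, 0) \<in> G"
  using partial_embedding_const[of G 0] by simp

lemma partial_embedding_one_one: "partial_embedding G \<Longrightarrow> (1, 1) \<in> G"
  using partial_embedding_const[of G 1] by simp

lemma partial_embedding_diff:
  assumes G: "partial_embedding G" and "(x, y) \<in> G" "(x', y') \<in> G"
  shows "(x - x', y - y') \<in> G"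
  using partial_embedding_add[OF G assms(2)
      partial_embedding_mult[OF G partial_embedding_const[OF G, of "-1"] assms(3)]] by simp

lemma partial_embedding_functional:
  assumes "partial_embedding G" and "(x, y) \<in> G" "(x, y') \<in> G"
  shows "y = y'"
  using partial_embedding_diff[OF assms] partial_embedding_zero[OF assms(1)] by fastforce

lemma partial_embedding_root_eval:
  assumes G: "partial_embedding G" and "(x, y) \<in> G"
  shows "(root_eval f x, root_eval f y) \<in> G"
proof (induction f)
  case 0 thus ?case using partial_embedding_zero_zero[OF G] by simp
next
  case (pCons a f)
  thus ?case
    using partial_embedding_add[OF G partial_embedding_const[OF G, of a]
        partial_embedding_mult[OF G assms(2)]] by simp
qed

text \<open>A subring containing \<open>K\<close> of an algebraic extension is a field, hence every partial embedding is
  injective.  Concretely, if \<open>x \<mapsto> 0\<close> then a polynomial over \<open>K\<close> vanishing at \<open>x\<close> has constant term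
  \<open>0\<close>; when \<open>x \<noteq> 0\<close> the factor \<open>X\<close> can be cancelled, and this repeats until nothing is left.\<close>

lemma partial_embedding_injective:
  assumes G: "partial_embedding G" and x: "(x, 0) \<in> G"
  shows "x = 0"
proof (rule ccontr)
  assume "x \<noteq> 0"
  have "f = 0" if "root_eval f x = 0" for f
    using that
  proof (induction f)
    case (pCons a f)
    have "(0, to_ac a) \<in> G"
      using partial_embedding_root_eval[OF G x, of "pCons a f"] unfolding pCons.prems by simp
    hence "to_ac a = 0" by (rule partial_embedding_zero[OF G])
    thus ?case using pCons \<open>x \<noteq> 0\<close> by simp
  qed simp
  thus False using alg_closure_algebraic[of x] by metis
qed

text \<open>The graph of the map that a partial embedding induces on polynomials over its domain.\<close>

definition coeffs_related ::
  "('a::field alg_closure \<times> 'a alg_closure) set \<Rightarrow> 'a alg_closure poly \<Rightarrow> 'a alg_closure poly \<Rightarrow> bool"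
  where "coeffs_related G f g \<longleftrightarrow> (\<forall>i. (poly.coeff f i, poly.coeff g i) \<in> G)"

lemma coeffs_related_const:
  "partial_embedding G \<Longrightarrow> (a, b) \<in> G \<Longrightarrow> coeffs_related G [:a:] [:b:]"
  by (auto simp: coeffs_related_def coeff_pCons partial_embedding_zero_zero split: nat.split)

lemma coeffs_related_monom:
  "partial_embedding G \<Longrightarrow> (a, b) \<in> G \<Longrightarrow> coeffs_related G (Polynomial.monom a k) (Polynomial.monom b k)"
  by (auto simp: coeffs_related_def partial_embedding_zero_zero)

lemma coeffs_related_add:
  "partial_embedding G \<Longrightarrow> coeffs_related G f g \<Longrightarrow> coeffs_related G f' g' \<Longrightarrow>
   coeffs_related G (f + f') (g + g')"
  by (auto simp: coeffs_related_def partial_embedding_add)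

lemma coeffs_related_diff:
  "partial_embedding G \<Longrightarrow> coeffs_related G f g \<Longrightarrow> coeffs_related G f' g' \<Longrightarrow>
   coeffs_related G (f - f') (g - g')"
  by (auto simp: coeffs_related_def partial_embedding_diff)

lemma coeffs_related_mult:
  assumes G: "partial_embedding G" and "coeffs_related G f g" "coeffs_related G f' g'"
  shows "coeffs_related G (f * f') (g * g')"
proof -
  have "(\<Sum>i\<in>I. poly.coeff f i * poly.coeff f' (n - i), \<Sum>i\<in>I. poly.coeff g i * poly.coeff g' (n - i)) \<in> G"
    for I :: "nat set" and n
    using assms(2,3)
    by (induction I rule: infinite_finite_induct)
       (auto simp: coeffs_related_def partial_embedding_zero_zero[OF G]
          intro!: partial_embedding_add[OF G] partial_embedding_mult[OF G])
  thus ?thesis by (simp add: coeffs_related_def Polynomial.coeff_mult)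
qed

lemma coeffs_related_map_poly: "partial_embedding G \<Longrightarrow> coeffs_related G (map_poly to_ac f) (map_poly to_ac f)"
  by (simp add: coeffs_related_def coeff_map_poly partial_embedding_const)

text \<open>A partial embedding extends to any further element \<open>x\<close>: take \<open>m\<close> of least degree vanishing at \<open>x\<close>
  with coefficients in the domain, and send \<open>x\<close> to a root \<open>y\<close> of the image \<open>m'\<close> of \<open>m\<close>.\<close>

lemma partial_embedding_extend:
  assumes G: "partial_embedding G"
  obtains G' y where "partial_embedding G'" "G \<subseteq> G'" "(x, y) \<in> G'"
proof -
  define P where "P = (\<lambda>f. f \<noteq> 0 \<and> poly f x = 0 \<and> (\<exists>g. coeffs_related G f g))"
  obtain f0 where f0: "f0 \<noteq> 0" "root_eval f0 x = 0" by (rule alg_closure_algebraic)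
  have "P (map_poly to_ac f0)"
    unfolding P_def using f0 coeffs_related_map_poly[OF G, of f0] by auto
  then obtain m where m: "P m" and min: "\<And>f. P f \<Longrightarrow> Polynomial.degree m \<le> Polynomial.degree f"
    using exists_least_iff[of "\<lambda>n. \<exists>f. P f \<and> Polynomial.degree f = n"]
    by (metis linorder_le_less_linear)
  obtain m' where m': "coeffs_related G m m'" using m by (auto simp: P_def)
  define c where "c = Polynomial.lead_coeff m"
  define c' where "c' = poly.coeff m' (Polynomial.degree m)"
  have cG: "(c, c') \<in> G" using m' by (simp add: c_def c'_def coeffs_related_def)
  have c0: "c \<noteq> 0" using m by (simp add: P_def c_def)
  hence c'0: "c' \<noteq> 0" using cG partial_embedding_injective[OF G] by blast
  have degm: "Polynomial.degree m > 0"
    using m by (auto simp: P_def elim!: Polynomial.degree_eq_zeroE intro!: Nat.gr0I)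
  \<comment> \<open>Injectivity keeps the leading coefficient of \<open>m\<close> nonzero, so \<open>m'\<close> is nonconstant and has a root.\<close>
  have "Polynomial.degree m' > 0"
    using c'0 degm le_degree[of m' "Polynomial.degree m"] by (simp add: c'_def)
  then obtain y where y: "poly m' y = 0"
    using alg_closed_imp_poly_has_root by blast
  \<comment> \<open>Well-definedness: reduce \<open>f\<close> modulo \<open>m\<close> and \<open>g\<close> modulo \<open>m'\<close> in parallel.  Cross-multiplying by the
     leading coefficients avoids inverses, as partial embeddings speak only of sums and products.\<close>
  have key: "poly g y = 0" if "coeffs_related G f g" "poly f x = 0" for f g
    using that
  proof (induction "Polynomial.degree f" arbitrary: f g rule: less_induct)
    case less
    show ?case
    proof (cases "f = 0")
      case True
      hence "g = 0"
        using less.prems partial_embedding_zero[OF G] by (intro poly_eqI) (auto simp: coeffs_related_def)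
      thus ?thesis by simp
    next
      case False
      define n where "n = Polynomial.degree f"
      define k where "k = n - Polynomial.degree m"
      have le: "Polynomial.degree m \<le> n"
        using less.prems False unfolding n_def by (intro min) (auto simp: P_def)
      define f1 where "f1 = [:c:] * f - Polynomial.monom (poly.coeff f n) k * m"
      define g1 where "g1 = [:c':] * g - Polynomial.monom (poly.coeff g n) k * m'"
      have rel: "coeffs_related G f1 g1"
        unfolding f1_def g1_def using less.prems(1) m'
        by (intro coeffs_related_diff coeffs_related_mult coeffs_related_const
            coeffs_related_monom G cG) (auto simp: coeffs_related_def)
      have "Polynomial.degree (Polynomial.monom (poly.coeff f n) k * m) \<le> n"
        using Polynomial.degree_mult_le[of "Polynomial.monom (poly.coeff f n) k" m]
          Polynomial.degree_monom_le[of "poly.coeff f n" k] le unfolding k_def by linarith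
      hence "Polynomial.degree f1 \<le> n"
        unfolding f1_def by (intro Polynomial.degree_diff_le) (simp_all add: n_def)
      moreover have "poly.coeff f1 n = 0"
        using le by (simp add: f1_def coeff_monom_mult k_def c_def)
      ultimately have "f1 = 0 \<or> Polynomial.degree f1 < n"
        using eq_zero_or_degree_less by blast
      hence "Polynomial.degree f1 < Polynomial.degree f"
        using le degm by (auto simp: n_def)
      moreover have "poly f1 x = 0" using less.prems m by (simp add: f1_def P_def)
      ultimately have "poly g1 y = 0" using less.hyps rel by blast
      thus ?thesis using c'0 y by (simp add: g1_def)
    qed
  qed
  define G' where "G' = {(poly f x, poly g y) | f g. coeffs_related G f g}"
  have in_G': "(poly f x, poly g y) \<in> G'" if "coeffs_related G f g" for f g
    using that by (auto simp: G'_def)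
  have sub: "G \<subseteq> G'"
    using in_G'[OF coeffs_related_const[OF G]] by auto
  have "partial_embedding G'"
    unfolding partial_embedding_def
  proof (intro conjI allI impI)
    show "(to_ac a, to_ac a) \<in> G'" for a
      using partial_embedding_const[OF G] sub by blast
  next
    fix u v u' v' assume "(u, v) \<in> G'" "(u', v') \<in> G'"
    then obtain f g f' g' where fg: "coeffs_related G f g" "coeffs_related G f' g'"
      "u = poly f x" "v = poly g y" "u' = poly f' x" "v' = poly g' y"
      by (auto simp: G'_def)
    show "(u + u', v + v') \<in> G'" "(u * u', v * v') \<in> G'"
      using in_G'[OF coeffs_related_add[OF G fg(1,2)]] in_G'[OF coeffs_related_mult[OF G fg(1,2)]]
      by (simp_all add: fg)
  next
    show "v = 0" if "(0, v) \<in> G'" for v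
      using that key by (auto simp: G'_def)
  qed
  moreover have "(x, y) \<in> G'"
    using in_G'[OF coeffs_related_monom[OF G partial_embedding_one_one[OF G], of 1]]
    by (simp add: poly_monom)
  ultimately show thesis using that sub by blast
qed

definition embedding :: "('a::field alg_closure \<Rightarrow> 'a alg_closure) \<Rightarrow> bool" where
  "embedding \<sigma> \<longleftrightarrow> (\<forall>a. \<sigma> (to_ac a) = to_ac a) \<and>
     (\<forall>x y. \<sigma> (x + y) = \<sigma> x + \<sigma> y) \<and> (\<forall>x y. \<sigma> (x * y) = \<sigma> x * \<sigma> y)"

text \<open>The map \<open>f(x) \<mapsto> f(y)\<close> is a partial embedding because \<open>p\<close> divides every \<open>f\<close> with \<open>f(x) = 0\<close>.  A
  maximal partial embedding above it is defined everywhere, since otherwise it would extend.\<close>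

lemma conjugate_roots:
  fixes p :: "'a::field poly"
  assumes p: "Factorial_Ring.irreducible p" and "root_eval p x = 0" "root_eval p y = 0"
  obtains \<sigma> where "embedding \<sigma>" "\<sigma> x = y"
proof -
  define G0 where "G0 = {(root_eval f x, root_eval f y) | f :: 'a poly. True}"
  have in_G0: "(root_eval f x, root_eval f y) \<in> G0" for f by (auto simp: G0_def)
  define A where "A = {G. partial_embedding G \<and> G0 \<subseteq> G}"
  have "partial_embedding G0"
    unfolding partial_embedding_def
  proof (intro conjI allI impI)
    show "(to_ac a, to_ac a) \<in> G0" for a
      using in_G0[of "[:a:]"] by simp
  next
    fix u v u' v' assume "(u, v) \<in> G0" "(u', v') \<in> G0"
    then obtain f g where "u = root_eval f x" "v = root_eval f y" "u' = root_eval g x" "v' = root_eval g y"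
      by (auto simp: G0_def)
    thus "(u + u', v + v') \<in> G0" "(u * u', v * v') \<in> G0"
      using in_G0[of "f + g"] in_G0[of "f * g"] by simp_all
  next
    fix v assume "(0, v) \<in> G0"
    then obtain f where f: "root_eval f x = 0" "v = root_eval f y" by (auto simp: G0_def)
    from irreducible_dvd_of_common_root[OF assms(1,2) f(1)] obtain h where "f = p * h" by (elim dvdE)
    thus "v = 0" using f assms(3) by simp
  qed
  hence "A \<noteq> {}" by (auto simp: A_def)
  moreover have "\<Union>C \<in> A" if "C \<noteq> {}" "subset.chain A C" for C
  proof -
    have PE: "partial_embedding G" if "G \<in> C" for G
      using that \<open>subset.chain A C\<close> by (auto simp: subset.chain_def A_def)
    have common: "\<exists>G\<in>C. a \<in> G \<and> b \<in> G" if "a \<in> \<Union>C" "b \<in> \<Union>C" for a b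
      using that \<open>subset.chain A C\<close> unfolding subset.chain_def by blast
    have "partial_embedding (\<Union>C)"
      unfolding partial_embedding_def
    proof (intro conjI allI impI)
      show "(to_ac a, to_ac a) \<in> \<Union>C" for a
        using \<open>C \<noteq> {}\<close> partial_embedding_const[OF PE] by blast
      fix u v u' v' assume "(u, v) \<in> \<Union>C" "(u', v') \<in> \<Union>C"
      with common obtain G where "G \<in> C" "(u, v) \<in> G" "(u', v') \<in> G" by blast
      thus "(u + u', v + v') \<in> \<Union>C" "(u * u', v * v') \<in> \<Union>C"
        using partial_embedding_add[OF PE] partial_embedding_mult[OF PE] by blast+
    next
      show "v = 0" if "(0, v) \<in> \<Union>C" for v
        using that partial_embedding_zero[OF PE] by blast
    qed
    moreover have "G0 \<subseteq> \<Union>C"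
      using \<open>C \<noteq> {}\<close> \<open>subset.chain A C\<close> unfolding subset.chain_def A_def by blast
    ultimately show ?thesis by (simp add: A_def)
  qed
  ultimately obtain G where GA: "G \<in> A" and max: "\<And>H. H \<in> A \<Longrightarrow> G \<subseteq> H \<Longrightarrow> H = G"
    using subset_Zorn_nonempty[of A] by blast
  have G: "partial_embedding G" "G0 \<subseteq> G" using GA by (auto simp: A_def)
  have total: "\<exists>v. (u, v) \<in> G" for u
  proof -
    obtain H v where H: "partial_embedding H" "G \<subseteq> H" "(u, v) \<in> H"
      using partial_embedding_extend[OF G(1)] .
    hence "H = G" using G(2) by (intro max) (auto simp: A_def)
    thus ?thesis using H(3) by blast
  qed
  then obtain \<sigma> where \<sigma>: "\<And>u. (u, \<sigma> u) \<in> G" by metis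
  have eq: "\<sigma> u = v" if "(u, v) \<in> G" for u v
    using partial_embedding_functional[OF G(1) \<sigma> that] .
  have "embedding \<sigma>"
    unfolding embedding_def
    using eq partial_embedding_const[OF G(1)] partial_embedding_add[OF G(1) \<sigma> \<sigma>]
      partial_embedding_mult[OF G(1) \<sigma> \<sigma>] by blast
  moreover have "\<sigma> x = y"
    using in_G0[of "Polynomial.monom 1 1"] G(2) by (intro eq) (auto simp: map_poly_monom poly_monom)
  ultimately show thesis by (rule that)
qed

lemma
  assumes "embedding \<sigma>"
  shows embedding_const: "\<sigma> (to_ac a) = to_ac a"
    and embedding_add: "\<sigma> (x + y) = \<sigma> x + \<sigma> y"
    and embedding_mult: "\<sigma> (x * y) = \<sigma> x * \<sigma> y"
  using assms unfolding embedding_def by blast+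

lemma embedding_0: "embedding \<sigma> \<Longrightarrow> \<sigma> 0 = 0"
  using embedding_const[of \<sigma> 0] by simp

lemma embedding_1: "embedding \<sigma> \<Longrightarrow> \<sigma> 1 = 1"
  using embedding_const[of \<sigma> 1] by simp

lemma embedding_diff: "embedding \<sigma> \<Longrightarrow> \<sigma> (x - y) = \<sigma> x - \<sigma> y"
  using embedding_add[of \<sigma> "x - y" y] by (simp add: eq_diff_eq)

lemma embedding_uminus: "embedding \<sigma> \<Longrightarrow> \<sigma> (- x) = - \<sigma> x"
  using embedding_diff[of \<sigma> 0 x] by (simp add: embedding_0)

lemma embedding_inverse:
  assumes "embedding \<sigma>" shows "\<sigma> (inverse x) = inverse (\<sigma> x)"
proof (cases "x = 0")
  case False
  hence "\<sigma> x * \<sigma> (inverse x) = 1"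
    using embedding_mult[OF assms, of x "inverse x"] embedding_1[OF assms] by simp
  thus ?thesis by (metis inverse_unique)
qed (simp add: embedding_0[OF assms])

lemma embedding_divide: "embedding \<sigma> \<Longrightarrow> \<sigma> (x / y) = \<sigma> x / \<sigma> y"
  by (simp add: divide_inverse embedding_mult embedding_inverse)

lemma embedding_eq_0_iff:
  assumes "embedding \<sigma>" shows "\<sigma> x = 0 \<longleftrightarrow> x = 0"
proof
  assume "\<sigma> x = 0"
  thus "x = 0"
    using embedding_mult[OF assms, of x "inverse x"] embedding_1[OF assms]
    by (metis mult_zero_left right_inverse zero_neq_one)
qed (simp add: embedding_0[OF assms])

lemma embedding_inj:
  assumes "embedding \<sigma>" shows "inj \<sigma>"
  using embedding_eq_0_iff[OF assms] embedding_diff[OF assms]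
  by (metis injI right_minus_eq)

lemma embedding_root_eval:
  assumes "embedding \<sigma>" shows "root_eval f (\<sigma> x) = \<sigma> (root_eval f x)"
  by (induction f)
     (simp_all add: embedding_0[OF assms] embedding_add[OF assms] embedding_mult[OF assms]
        embedding_const[OF assms])

text \<open>An injective self-map of the finite set of roots is onto.  As every element is such a root, an
  embedding is an automorphism.\<close>

lemma embedding_permutes_roots:
  assumes "embedding \<sigma>" and "f \<noteq> 0"
  shows "\<sigma> ` roots_in_closure f = roots_in_closure f"
proof (rule endo_inj_surj)
  show "finite (roots_in_closure f)" by (rule finite_roots_in_closure) fact
  show "\<sigma> ` roots_in_closure f \<subseteq> roots_in_closure f"
    using embedding_root_eval[OF assms(1)] embedding_0[OF assms(1)] by auto
  show "inj_on \<sigma> (roots_in_closure f)"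
    using embedding_inj[OF assms(1)] by (rule inj_on_subset) simp
qed

lemma embedding_surj:
  assumes "embedding \<sigma>" shows "surj \<sigma>"
proof -
  have "y \<in> range \<sigma>" for y
  proof -
    obtain f where "f \<noteq> 0" "root_eval f y = 0" by (rule alg_closure_algebraic)
    hence "y \<in> \<sigma> ` roots_in_closure f" using embedding_permutes_roots[OF assms] by simp
    thus ?thesis by blast
  qed
  thus ?thesis by blast
qed

lemma deg_over_embedding:
  assumes "embedding \<sigma>" shows "deg_over (\<sigma> x) = deg_over x"
proof -
  obtain m where m: "Factorial_Ring.irreducible m" "root_eval m x = 0"
    by (rule root_has_irreducible_poly[of x])
  have "root_eval m (\<sigma> x) = 0"
    using m embedding_root_eval[OF assms] embedding_0[OF assms] by simp
  thus ?thesis using m deg_over_eq_degree by metis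
qed

section \<open>Conjugation preserves the valuation of a henselian field\<close>

lemma
  assumes "is_valuation u"
  shows valuation_ne_Minf: "u x \<noteq> -\<infinity>"
    and valuation_eq_Pinf_iff: "u x = \<infinity> \<longleftrightarrow> x = 0"
    and valuation_mult: "u (x * y) = u x + u y"
    and valuation_add: "min (u x) (u y) \<le> u (x + y)"
  using assms unfolding is_valuation_def by blast+

lemma valuation_1:
  assumes "is_valuation u" shows "u 1 = 0"
proof -
  obtain g where "u 1 = Fin g"
    using valuation_ne_Minf[OF assms, of 1] valuation_eq_Pinf_iff[OF assms, of 1]
    by (cases "u 1") auto
  thus ?thesis using valuation_mult[OF assms, of 1 1] by (simp add: zero_extended_def)
qed

lemma valuation_uminus:
  assumes "is_valuation u" shows "u (- x) = u x"
proof -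
  obtain g where g: "u (- 1) = Fin g"
    using valuation_ne_Minf[OF assms, of "-1"] valuation_eq_Pinf_iff[OF assms, of "-1"]
    by (cases "u (- 1)") auto
  have "g + g = 0"
    using valuation_mult[OF assms, of "-1" "-1"] g
    by (simp add: valuation_1[OF assms] zero_extended_def)
  hence "u (- 1) = 0"
    using g by (simp add: zero_extended_def)
  thus ?thesis using valuation_mult[OF assms, of "-1" x] by simp
qed

lemma valuation_diff: "is_valuation u \<Longrightarrow> min (u x) (u y) \<le> u (x - y)"
  using valuation_add[of u x "- y"] valuation_uminus[of u y] by simp

lemma valuation_add_eq:
  assumes "is_valuation u" and "u x < u y"
  shows "u (x + y) = u x"
  using assms(2) valuation_add[OF assms(1), of x y] valuation_diff[OF assms(1), of "x + y" y]
  by (auto simp: min_def split: if_splits)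

lemma valuation_divide_nonneg_iff:
  assumes "is_valuation u" and "y \<noteq> 0"
  shows "0 \<le> u (x / y) \<longleftrightarrow> u y \<le> u x"
proof -
  obtain g where g: "u y = Fin g"
    using valuation_ne_Minf[OF assms(1), of y] valuation_eq_Pinf_iff[OF assms(1), of y] assms(2)
    by (cases "u y") auto
  have "u x = u (x / y) + Fin g"
    using valuation_mult[OF assms(1), of "x / y" y] g assms(2) by simp
  thus ?thesis using g by (cases "u (x / y)") (auto simp: zero_extended_def)
qed

text \<open>The property whose unique solution characterizes a henselian \<open>v\<close>: \<open>A\<close> is a valuation ring of the
  closure lying over the valuation ring of \<open>v\<close>.\<close>

definition valuation_ring_over ::
  "('a::field \<Rightarrow> 'g::linordered_ab_group_add extended) \<Rightarrow> 'a alg_closure set \<Rightarrow> bool"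
  where
  "valuation_ring_over v A \<longleftrightarrow>
     subring A (ring_of_type_algebra :: 'a alg_closure ring) \<and>
     (\<forall>x. x \<noteq> 0 \<longrightarrow> x \<in> A \<or> inverse x \<in> A) \<and>
     (\<forall>a. to_ac a \<in> A \<longleftrightarrow> 0 \<le> v a)"

lemma valuation_ring_over_pullback:
  fixes vbar :: "'a::field alg_closure \<Rightarrow> 'g::linordered_ab_group_add extended"
  assumes u: "is_valuation vbar" and ext: "extends_to_closure vbar v" and s: "embedding \<sigma>"
  shows "valuation_ring_over v {x. 0 \<le> vbar (\<sigma> x)}"
proof -
  interpret L: field "ring_of_type_algebra :: 'a alg_closure ring" by rule
  have "subring {x. 0 \<le> vbar (\<sigma> x)} (ring_of_type_algebra :: 'a alg_closure ring)"
  proof (rule L.subringI)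
    show "\<one>\<^bsub>ring_of_type_algebra\<^esub> \<in> {x. 0 \<le> vbar (\<sigma> x)}"
      by (simp add: ring_of_type_simps embedding_1[OF s] valuation_1[OF u])
    show "\<ominus>\<^bsub>ring_of_type_algebra\<^esub> x \<in> {x. 0 \<le> vbar (\<sigma> x)}" if "x \<in> {x. 0 \<le> vbar (\<sigma> x)}" for x
      using that by (simp add: ring_of_type_uminus embedding_uminus[OF s] valuation_uminus[OF u])
    show "x \<otimes>\<^bsub>ring_of_type_algebra\<^esub> y \<in> {x. 0 \<le> vbar (\<sigma> x)}"
      if "x \<in> {x. 0 \<le> vbar (\<sigma> x)}" "y \<in> {x. 0 \<le> vbar (\<sigma> x)}" for x y
      using that add_mono[of 0 "vbar (\<sigma> x)" 0 "vbar (\<sigma> y)"]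
      by (simp add: ring_of_type_simps embedding_mult[OF s] valuation_mult[OF u])
    show "x \<oplus>\<^bsub>ring_of_type_algebra\<^esub> y \<in> {x. 0 \<le> vbar (\<sigma> x)}"
      if "x \<in> {x. 0 \<le> vbar (\<sigma> x)}" "y \<in> {x. 0 \<le> vbar (\<sigma> x)}" for x y
      using that valuation_add[OF u, of "\<sigma> x" "\<sigma> y"]
      by (auto simp: ring_of_type_simps embedding_add[OF s] min_def split: if_splits)
  qed (simp add: ring_of_type_simps)
  moreover have "0 \<le> vbar (\<sigma> x) \<or> 0 \<le> vbar (\<sigma> (inverse x))" if "x \<noteq> 0" for x
  proof -
    have "0 \<le> vbar (inverse (\<sigma> x)) \<longleftrightarrow> vbar (\<sigma> x) \<le> 0"
      using valuation_divide_nonneg_iff[OF u, of "\<sigma> x" 1] valuation_1[OF u] that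
      by (simp add: embedding_eq_0_iff[OF s] inverse_eq_divide)
    thus ?thesis using linear[of 0 "vbar (\<sigma> x)"] by (auto simp: embedding_inverse[OF s])
  qed
  ultimately show ?thesis
    using ext by (auto simp: valuation_ring_over_def extends_to_closure_def embedding_const[OF s])
qed

text \<open>If some element moved up, take \<open>z\<close> maximal among those with \<open>lt z (\<sigma> z)\<close>; then \<open>\<sigma> z\<close> moves up as
  well and lies above \<open>z\<close>.\<close>

lemma monotone_self_map_not_increasing:
  assumes "finite R" and "asymp_on R lt" and "transp_on R lt"
    and "\<And>y. y \<in> R \<Longrightarrow> \<sigma> y \<in> R" and "\<And>y z. lt y z \<Longrightarrow> lt (\<sigma> y) (\<sigma> z)"
    and "x \<in> R"
  shows "\<not> lt x (\<sigma> x)"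
proof
  assume "lt x (\<sigma> x)"
  then obtain z where "z \<in> R" "lt z (\<sigma> z)" "\<forall>y\<in>R. lt z y \<longrightarrow> \<not> lt y (\<sigma> y)"
    using Finite_Set.bex_max_element_with_property[OF assms(1-3), of "\<lambda>z. lt z (\<sigma> z)"] assms(6)
    by blast
  thus False using assms(4,5) by blast
qed

text \<open>The valuation ring of \<open>vbar\<close> and its preimage under \<open>\<sigma>\<close> both lie over \<open>v\<close>, so they coincide.  The
  henselian property yields only this equality of rings, which says that \<open>\<sigma>\<close> preserves the order
  of values.  Equality of values follows because the orbit of \<open>x\<close> consists of roots of one
  polynomial, and an order-preserving map moves no element of a finite set up or down.\<close>

lemma henselian_embedding_invariant:
  fixes vbar :: "'a::field alg_closure \<Rightarrow> 'g::linordered_ab_group_add extended"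
  assumes "henselian v" and u: "is_valuation vbar" and ext: "extends_to_closure vbar v"
    and s: "embedding \<sigma>"
  shows "vbar (\<sigma> x) = vbar x"
proof -
  have "embedding (\<lambda>x. x)" by (simp add: embedding_def)
  hence "valuation_ring_over v {x. 0 \<le> vbar x}"
    by (rule valuation_ring_over_pullback[OF u ext])
  moreover have "valuation_ring_over v {x. 0 \<le> vbar (\<sigma> x)}"
    using s by (rule valuation_ring_over_pullback[OF u ext])
  moreover have "\<exists>!A. valuation_ring_over v A"
    using \<open>henselian v\<close> unfolding henselian_def valuation_ring_over_def .
  ultimately have "{x. 0 \<le> vbar (\<sigma> x)} = {x. 0 \<le> vbar x}" by blast
  hence nonneg: "0 \<le> vbar (\<sigma> y) \<longleftrightarrow> 0 \<le> vbar y" for y by blast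
  have le_iff: "vbar (\<sigma> y) \<le> vbar (\<sigma> z) \<longleftrightarrow> vbar y \<le> vbar z" for y z
  proof (cases "y = 0")
    case True
    hence inf: "vbar y = \<infinity>" "vbar (\<sigma> y) = \<infinity>"
      using valuation_eq_Pinf_iff[OF u] by (simp_all add: embedding_eq_0_iff[OF s])
    show ?thesis
      unfolding inf by (simp add: valuation_eq_Pinf_iff[OF u] embedding_eq_0_iff[OF s])
  next
    case False
    thus ?thesis
      using nonneg[of "z / y"] valuation_divide_nonneg_iff[OF u, of y z]
        valuation_divide_nonneg_iff[OF u, of "\<sigma> y" "\<sigma> z"]
      by (simp add: embedding_divide[OF s] embedding_eq_0_iff[OF s])
  qed
  obtain f where f: "f \<noteq> 0" "root_eval f x = 0" by (rule alg_closure_algebraic)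
  define R where "R = roots_in_closure f"
  have fin: "finite R" unfolding R_def by (rule finite_roots_in_closure[OF f(1)])
  have R: "\<sigma> y \<in> R" if "y \<in> R" for y
    using that embedding_permutes_roots[OF s f(1)] unfolding R_def by blast
  have lt: "vbar (\<sigma> y) < vbar (\<sigma> z)" if "vbar y < vbar z" for y z
    using that le_iff[of z y] by (simp add: not_le[symmetric])
  have "x \<in> R" using f by (simp add: R_def)
  have "\<not> vbar x < vbar (\<sigma> x)"
    by (rule monotone_self_map_not_increasing[OF fin, of "\<lambda>y z. vbar y < vbar z"])
       (use R lt \<open>x \<in> R\<close> in \<open>auto intro!: asymp_onI transp_onI\<close>)
  moreover have "\<not> vbar (\<sigma> x) < vbar x"
    by (rule monotone_self_map_not_increasing[OF fin, of "\<lambda>y z. vbar z < vbar y"])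
       (use R lt \<open>x \<in> R\<close> in \<open>auto intro!: asymp_onI transp_onI\<close>)
  ultimately show ?thesis by simp
qed

lemma distinguished_pair_embedding:
  fixes vbar :: "'a::field alg_closure \<Rightarrow> 'g::linordered_ab_group_add extended"
  assumes inv: "\<And>x. vbar (\<sigma> x) = vbar x" and s: "embedding \<sigma>"
    and "distinguished_pair vbar \<theta> \<alpha>"
  shows "distinguished_pair vbar (\<sigma> \<theta>) (\<sigma> \<alpha>)"
proof -
  have dist: "vbar (\<sigma> x - \<sigma> y) = vbar (x - y)" for x y
    using inv[of "x - y"] by (simp add: embedding_diff[OF s])
  have all: "(\<forall>z. P z) \<longleftrightarrow> (\<forall>z. P (\<sigma> z))" for P :: "_ \<Rightarrow> bool"
    using embedding_surj[OF s] by (metis surjD)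
  show ?thesis
    using assms(3) unfolding distinguished_pair_def
    by (subst (1 2) all) (simp add: dist deg_over_embedding[OF s])
qed

section \<open>Optimal values and distinguished pairs\<close>

lemma optimal_value_attained:
  assumes "Polynomial.degree f > 0"
  obtains \<alpha> where "root_eval f \<alpha> = 0" "wbar (to_fract [:- \<alpha>, 1:]) = optimal_value wbar f"
proof -
  have "optimal_value wbar f \<in> (\<lambda>\<alpha>. wbar (to_fract [:- \<alpha>, 1:])) ` roots_in_closure f"
    unfolding optimal_value_def using roots_in_closure_nonempty[OF assms] assms
    by (intro Max_in finite_imageI finite_roots_in_closure) auto
  thus thesis using that by auto
qed

lemma optimal_value_ge:
  assumes "Polynomial.degree f > 0" and "root_eval f \<alpha> = 0"
  shows "wbar (to_fract [:- \<alpha>, 1:]) \<le> optimal_value wbar f"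
  unfolding optimal_value_def using assms
  by (intro Max_ge finite_imageI finite_roots_in_closure) auto

lemma valuation_diff_of_linear:
  assumes "is_valuation wbar" and "extends_to_rat_fun wbar vbar"
    and "wbar (to_fract [:- \<beta>, 1:]) < wbar (to_fract [:- \<theta>, 1:])"
  shows "vbar (\<theta> - \<beta>) = wbar (to_fract [:- \<beta>, 1:])"
proof -
  have "to_fract [:- \<beta>, 1:] + - to_fract [:- \<theta>, 1:] = const_fract (\<theta> - \<beta>)"
    by (simp add: const_fract_def flip: to_fract_uminus to_fract_add)
  thus ?thesis
    using valuation_add_eq[OF assms(1), of "to_fract [:- \<beta>, 1:]" "- to_fract [:- \<theta>, 1:]"] assms(2,3)
    by (simp add: valuation_uminus[OF assms(1)] extends_to_rat_fun_def)
qed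

lemma irreducible_degree_pos:
  fixes p :: "'a::field poly"
  assumes "Factorial_Ring.irreducible p" shows "Polynomial.degree p > 0"
  using assms by (auto simp: Factorial_Ring.irreducible_def is_unit_iff_degree intro!: Nat.gr0I)

text \<open>Conjugating, one may assume that the root \<open>\<theta>\<close> of \<open>g\<close> in the distinguished pair is an optimizing root.
  Every root \<open>\<beta>\<close> of a polynomial of smaller degree than \<open>g\<close> satisfies \<open>wbar (X - \<beta>) < wbar (X - \<theta>)\<close>, and
  therefore \<open>vbar (\<theta> - \<beta>) = wbar (X - \<beta>)\<close>.  The condition on elements \<open>\<eta>\<close> of degree less than \<open>deg \<alpha>\<close>
  thus turns into a comparison of optimal values.\<close>

lemma ABKP_distinguished_pair:
  fixes vbar :: "'a::field alg_closure \<Rightarrow> 'g::linordered_ab_group_add extended"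
  assumes hens: "henselian v" and u: "is_valuation vbar" and ext: "extends_to_closure vbar v"
    and w: "is_valuation wbar" "extends_to_rat_fun wbar vbar"
    and g: "is_ABKP wbar g" "Factorial_Ring.irreducible g"
    and f: "Factorial_Ring.irreducible f" "Polynomial.lead_coeff f = 1"
    and pair: "distinguished_poly_pair vbar g f"
  shows "is_ABKP wbar f \<and> optimal_value wbar f < optimal_value wbar g"
proof -
  let ?val = "\<lambda>\<alpha>. wbar (to_fract [:- \<alpha>, 1:])"
  have degf: "Polynomial.degree f > 0" and degg: "Polynomial.degree g > 0"
    using f(1) g(2) irreducible_degree_pos by auto
  obtain \<theta>' where \<theta>': "root_eval g \<theta>' = 0" "?val \<theta>' = optimal_value wbar g"
    using optimal_value_attained[OF degg] .
  obtain \<theta> \<alpha> where \<theta>\<alpha>: "root_eval g \<theta> = 0" "root_eval f \<alpha> = 0" "distinguished_pair vbar \<theta> \<alpha>"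
    using pair by (auto simp: distinguished_poly_pair_def)
  obtain \<sigma> where s: "embedding \<sigma>" "\<sigma> \<theta> = \<theta>'"
    using conjugate_roots[OF g(2) \<theta>\<alpha>(1) \<theta>'(1)] .
  define \<alpha>' where "\<alpha>' = \<sigma> \<alpha>"
  have \<alpha>': "root_eval f \<alpha>' = 0"
    using \<theta>\<alpha>(2) by (simp add: \<alpha>'_def embedding_root_eval[OF s(1)] embedding_0[OF s(1)])
  have dp: "distinguished_pair vbar \<theta>' \<alpha>'"
    using distinguished_pair_embedding[OF henselian_embedding_invariant[OF hens u ext s(1)] s(1) \<theta>\<alpha>(3)]
    by (simp add: \<alpha>'_def s(2))
  have da: "deg_over \<alpha>' = Polynomial.degree f" and dt: "deg_over \<theta>' = Polynomial.degree g"
    using deg_over_eq_degree f(1) g(2) \<alpha>' \<theta>'(1) by auto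
  have fg: "Polynomial.degree f < Polynomial.degree g"
    using dp by (simp add: distinguished_pair_def da dt)
  have less: "optimal_value wbar h < optimal_value wbar g"
    if "0 < Polynomial.degree h" "Polynomial.degree h < Polynomial.degree g" for h
    using g(1) that by (auto simp: is_ABKP_def)
  have near: "vbar (\<theta>' - \<beta>) = ?val \<beta>"
    if "root_eval h \<beta> = 0" "0 < Polynomial.degree h" "Polynomial.degree h < Polynomial.degree g" for h \<beta>
    using optimal_value_ge[OF that(2,1), of wbar] less[OF that(2,3)] \<theta>'(2)
    by (intro valuation_diff_of_linear[OF w]) simp
  have "optimal_value wbar h < optimal_value wbar f"
    if h: "0 < Polynomial.degree h" "Polynomial.degree h < Polynomial.degree f" for h
  proof -
    obtain \<beta> where \<beta>: "root_eval h \<beta> = 0" "?val \<beta> = optimal_value wbar h"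
      using optimal_value_attained[OF h(1)] .
    have "deg_over \<beta> < deg_over \<alpha>'"
      using deg_over_le_degree[OF _ \<beta>(1)] h da by fastforce
    hence "vbar (\<theta>' - \<beta>) < vbar (\<theta>' - \<alpha>')"
      using dp by (simp add: distinguished_pair_def)
    hence "?val \<beta> < ?val \<alpha>'"
      using near[OF \<beta>(1) h(1)] near[OF \<alpha>' degf fg] h(2) fg by simp
    thus ?thesis
      using \<beta>(2) optimal_value_ge[OF degf \<alpha>', of wbar] by simp
  qed
  thus ?thesis using less[OF degf fg] f(2) degf by (simp add: is_ABKP_def)
qed

section \<open>Distinguished chains\<close>

lemma well_order_on_strict_mono:
  fixes d :: "nat \<Rightarrow> 'b::linorder"
  assumes "\<And>i j. i < j \<Longrightarrow> j \<le> r \<Longrightarrow> d i < d j"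
  shows "well_order_on {0..r} {(i, j) \<in> {0..r} \<times> {0..r}. d i \<le> d j}"
proof -
  have "d i \<le> d j \<longleftrightarrow> i \<le> j" if "i \<le> r" "j \<le> r" for i j
    using assms[of i j] assms[of j i] that by (cases i j rule: linorder_cases) auto
  hence eq: "{(i, j) \<in> {0..r} \<times> {0..r}. d i \<le> d j} = {(i, j) \<in> {0..r} \<times> {0..r}. i \<le> j}"
    by auto
  have "wf ({(i, j) \<in> {0..r} \<times> {0..r}. i \<le> j} - Id)"
    by (rule wf_subset[OF wf_less]) auto
  moreover have "linear_order_on {0..r} {(i, j) \<in> {0..r} \<times> {0..r}. i \<le> j}"
    by (auto simp: linear_order_on_def partial_order_on_def preorder_on_def refl_on_def trans_def
        antisym_def total_on_def)
  ultimately show ?thesis unfolding eq well_order_on_def by simp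
qed

theorem theorem2p16:
  fixes v :: "'a::field \<Rightarrow> 'g::linordered_ab_group_add extended"
    and vbar :: "'a alg_closure \<Rightarrow> 'g extended"
    and w :: "'a poly fract \<Rightarrow> 'g extended"
    and wbar :: "'a alg_closure poly fract \<Rightarrow> 'g extended"
    and Q :: "'a poly"
    and Qs :: "nat \<Rightarrow> 'a poly"
    and r :: nat
  assumes "is_valuation v" and "henselian v"
    and "is_valuation vbar" and "extends_to_closure vbar v"
    and "is_valuation w" and "extends_to_rat_fun w v"
    and "is_valuation wbar" and "extends_to_rat_fun wbar vbar"
    and "extends_to_closure_rat_fun wbar w"
    and "valuation_transcendental v w"
    and "is_ABKP wbar Q"
    and "\<forall>f. w (to_fract f) = truncation w Q f"
    and "saturated_distinguished_chain vbar Q r Qs"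
  shows "complete_set_of_ABKPs w wbar {0..r} Qs"
proof -
  have chain: "Qs r = Q" "\<And>i. i \<le> r \<Longrightarrow> Polynomial.lead_coeff (Qs i) = 1"
    "\<And>i. i \<le> r \<Longrightarrow> Factorial_Ring.irreducible (Qs i)"
    "\<And>i. i < r \<Longrightarrow> distinguished_poly_pair vbar (Qs (Suc i)) (Qs i)"
    using assms(13) unfolding saturated_distinguished_chain_def by blast+
  let ?d = "\<lambda>i. optimal_value wbar (Qs i)"
  have down: "is_ABKP wbar (Qs i) \<and> ?d i < ?d (Suc i)" if "i < r" "is_ABKP wbar (Qs (Suc i))" for i
    using that chain by (intro ABKP_distinguished_pair[OF assms(2-4,7,8)]) auto
  have ABKP: "is_ABKP wbar (Qs i)" if "i \<le> r" for i
    using that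
  proof (induction rule: inc_induct)
    case base show ?case using assms(11) chain(1) by simp
  next
    case (step n) thus ?case using down by blast
  qed
  have mono: "?d i < ?d j" if "i < j" "j \<le> r" for i j
    using that
  proof (induction rule: strict_inc_induct)
    case base thus ?case using down ABKP by simp
  next
    case (step i)
    have "?d i < ?d (Suc i)" using down[of i] ABKP[of "Suc i"] step by simp
    also have "\<dots> < ?d j" using step by simp
    finally show ?case .
  qed
  have "\<exists>i\<in>{0..r}. truncation w (Qs i) f = w (to_fract f)" for f
    using assms(12) chain(1) by auto
  moreover have "?d i \<noteq> ?d j" if "i \<in> {0..r}" "j \<in> {0..r}" "i \<noteq> j" for i j
    using mono[of i j] mono[of j i] that by (cases i j rule: linorder_cases) auto
  ultimately show ?thesis
    unfolding complete_set_of_ABKPs_def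
    using ABKP mono well_order_on_strict_mono[of r ?d] by auto
qed

end
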